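(* (Hyperbolic Koteljanskii inequality.) Let $P$ be a homogeneous PSD-stable lpm polynomial on real symmetric $n\times n$ matrices and let $S,T\subseteq[n]$. Then $$P|_S(A)\,P|_T(A)\ \ge\ P|_{S\cup T}(A)\,P|_{S\cap T}(A)$$ holds for all $A\in H(P)$.
   Context: $X$ is a symmetric $n\times n$ matrix of indeterminates, and $X_J$ is its principal submatrix indexed by $J\subseteq[n]=\{1,\dots,n\}$ (with $\det X_\emptyset=1$). A linear principal minor polynomial (lpm polynomial) is a polynomial of the form $P(X)=\sum_{J\subseteq[n]}c_J\det(X_J)$ with $c_J\in\mathbb{R}$. A polynomial $P$ on symmetric matrices is PSD-stable if it has no zero among complex symmetric matrices with positive definite imaginary part. A homogeneous PSD-stable $P$ is hyperbolic with respect to the identity matrix $I$, i.e. $P(I)\neq0$ and $P(A-tI)$ has only real roots in $t$ for every real symmetric $A$; $H(P)$ is the set of real symmetric $A$ such that all roots of $P(A-tI)$ are nonnegative. For $T\subseteq[n]$ the restriction of $P$ is $P|_T:=\Bigl(\prod_{i\in[n]\setminus T}\frac{\partial}{\partial X_{ii}}\Bigr)P$, the partial derivatives being taken with respect to the diagonal variables with index not in $T$ (if $|T|<n-\deg P$ this is the zero polynomial). *)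

theory Defs
  imports "HOL-Analysis.Analysis" "HOL-Library.Poly_Mapping"
begin

section \<open>Polynomials in the entries of a symmetric matrix\<close>

text \<open>
  A monomial maps each variable to its exponent; a polynomial maps each monomial to its
  coefficient. The variable (i, j) stands for the matrix entry in row i and column j. In a
  symmetric matrix of indeterminates the entries (i, j) and (j, i) are the same variable, and
  the ordering of the index type serves to choose the representative with i \<le> j.
\<close>

type_synonym 'n matrix_poly = "(('n \<times> 'n) \<Rightarrow>\<^sub>0 nat) \<Rightarrow>\<^sub>0 real"

definition const_poly :: "real \<Rightarrow> 'n matrix_poly" where
  "const_poly c = Poly_Mapping.single 0 c"

definition indet :: "'n \<times> 'n \<Rightarrow> 'n matrix_poly" where
  "indet v = Poly_Mapping.single (Poly_Mapping.single v 1) 1"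

definition sym_indets :: "'n matrix_poly ^ 'n::{finite,linorder} ^ 'n::{finite,linorder}" where
  "sym_indets = (\<chi> i j. indet (min i j, max i j))"

definition eval_poly :: "'n::finite matrix_poly \<Rightarrow> 'a::{real_algebra_1,comm_ring_1} ^ 'n ^ 'n \<Rightarrow> 'a" where
  "eval_poly P A =
     (\<Sum>m\<in>Poly_Mapping.keys P. of_real (Poly_Mapping.lookup P m) *
        (\<Prod>v\<in>Poly_Mapping.keys m. (A $ fst v $ snd v) ^ Poly_Mapping.lookup m v))"

definition homogeneous :: "'n matrix_poly \<Rightarrow> bool" where
  "homogeneous P \<longleftrightarrow>
     (\<exists>d. \<forall>m\<in>Poly_Mapping.keys P. (\<Sum>v\<in>Poly_Mapping.keys m. Poly_Mapping.lookup m v) = d)"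

text \<open>
  Termwise differentiation. If v does not occur in the monomial m, the truncated subtraction
  leaves m unchanged, but then the coefficient is 0.
\<close>

definition partial_deriv :: "'n \<times> 'n \<Rightarrow> 'n matrix_poly \<Rightarrow> 'n matrix_poly" where
  "partial_deriv v P =
     (\<Sum>m\<in>Poly_Mapping.keys P.
        Poly_Mapping.single (m - Poly_Mapping.single v 1)
          (of_nat (Poly_Mapping.lookup m v) * Poly_Mapping.lookup P m))"

text \<open>Partial derivatives commute; the increasing order of the indices is an arbitrary choice.\<close>

definition restriction :: "'n::{finite,linorder} set \<Rightarrow> 'n matrix_poly \<Rightarrow> 'n matrix_poly" where
  "restriction T P = fold (\<lambda>i. partial_deriv (i, i)) (sorted_list_of_set (- T)) P"

section \<open>Linear principal minor polynomials\<close>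

text \<open>
  The Leibniz formula for the determinant of the submatrix with rows and columns in J; it applies
  over any commutative ring, in particular to the matrix of indeterminates.
\<close>

definition principal_minor :: "'n::finite set \<Rightarrow> 'a::comm_ring_1 ^ 'n ^ 'n \<Rightarrow> 'a" where
  "principal_minor J M = (\<Sum>p | p permutes J. of_int (sign p) * (\<Prod>i\<in>J. M $ i $ p i))"

lemma principal_minor_empty: "principal_minor {} M = 1"
  by (simp add: principal_minor_def)

lemma principal_minor_UNIV: "principal_minor UNIV M = det M"
  by (simp add: principal_minor_def det_def)

definition lpm_polynomial :: "'n::{finite,linorder} matrix_poly \<Rightarrow> bool" where
  "lpm_polynomial P \<longleftrightarrow>
     (\<exists>c :: 'n set \<Rightarrow> real. P = (\<Sum>J\<in>UNIV. const_poly (c J) * principal_minor J sym_indets))"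

section \<open>Stability and the hyperbolicity cone\<close>

definition symmetric_matrix :: "'a ^ 'n ^ 'n \<Rightarrow> bool" where
  "symmetric_matrix A \<longleftrightarrow> transpose A = A"

definition positive_definite :: "real ^ 'n ^ 'n \<Rightarrow> bool" where
  "positive_definite A \<longleftrightarrow> symmetric_matrix A \<and> (\<forall>x. x \<noteq> 0 \<longrightarrow> x \<bullet> (A *v x) > 0)"

definition psd_stable :: "'n::finite matrix_poly \<Rightarrow> bool" where
  "psd_stable P \<longleftrightarrow>
     (\<forall>Z :: complex ^ 'n ^ 'n.
        symmetric_matrix Z \<and> positive_definite (\<chi> i j. Im (Z $ i $ j)) \<longrightarrow> eval_poly P Z \<noteq> 0)"

text \<open>
  The hyperbolicity cone with respect to the identity matrix. The roots of
  P (A - t I) are taken over the complex numbers; mat t is t times the identity.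
\<close>

definition hyperbolicity_cone :: "'n::finite matrix_poly \<Rightarrow> (real ^ 'n ^ 'n) set" where
  "hyperbolicity_cone P =
     {A. symmetric_matrix A \<and>
         (\<forall>t::complex. eval_poly P ((\<chi> i j. of_real (A $ i $ j)) - mat t) = 0 \<longrightarrow> t \<in> \<real>\<^sub>\<ge>\<^sub>0)}"

end

theory Submission
  imports Defs
begin

text \<open>
  Let d_U P be the derivative of P in the diagonal variables with index in U, so that P|_S is d_U P
  for U the complement of S. With f (U) the value of d_U P at A, and X, Y the complements of S, T,
  the claim reads f (X \<inter> Y) f (X \<union> Y) \<le> f (X) f (Y).

  An lpm polynomial has degree at most one in each diagonal variable. Hence adding s to the i-th
  diagonal entry of the matrix changes the value of d_U P, for i outside U, by s times the value of
  d_U' P with U' = U \<union> {i} (\<open>eval_poly_bump\<close>). The proof combines three consequences.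

  Pairs of indices: as a function of two diagonal variables P is a + s b + t (c + s d), and
  stability forces a d \<le> b c at every real symmetric matrix (\<open>psd_stable_imp_rayleigh\<close>).
  Comparing leading coefficients in a third variable carries this over to every d_U P
  (\<open>rayleigh_deriv\<close>).

  Signs: on the ray A + t I from an interior point A of the cone, the same inequalities make the
  quotient of a diagonal derivative by P monotone in t. It tends to 0, so the derivative has the
  sign of P (\<open>positive_ray_diag_deriv_nonneg\<close>). Thus P keeps its sign when nonnegative amounts are
  added to the diagonal of A, and so do all d_U P, being slopes of functions of constant
  sign (\<open>orthant_nonneg_derivs\<close>). Points of the cone itself are limits of such A.

  Pairs of sets: if f is positive on the subsets of X \<union> Y, the inequalities for pairs of
  indices telescope to the claim (\<open>log_submodular_of_local\<close>). If f (X \<union> Y) = 0 the claim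
  follows from the signs. Otherwise all values on subsets become strictly positive at A + \<epsilon> I
  for \<epsilon> > 0 (\<open>orthant_nonneg_derivs_pos\<close>), and \<epsilon> tends to 0.
\<close>

section \<open>Evaluation and termwise differentiation\<close>

definition eval_monomial ::
  "(('n::finite \<times> 'n) \<Rightarrow>\<^sub>0 nat) \<Rightarrow> 'a::{real_algebra_1,comm_ring_1} ^ 'n ^ 'n \<Rightarrow> 'a" where
  "eval_monomial m A = (\<Prod>v\<in>UNIV. (A $ fst v $ snd v) ^ Poly_Mapping.lookup m v)"

lemma eval_poly_superset:
  assumes "finite K" "Poly_Mapping.keys P \<subseteq> K"
  shows "eval_poly P A = (\<Sum>m\<in>K. of_real (Poly_Mapping.lookup P m) * eval_monomial m A)"
proof -
  have "(\<Prod>v\<in>Poly_Mapping.keys m. (A $ fst v $ snd v) ^ Poly_Mapping.lookup m v) = eval_monomial m A" for m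
    unfolding eval_monomial_def by (rule prod.mono_neutral_left) (auto simp: in_keys_iff)
  then show ?thesis
    unfolding eval_poly_def using assms
    by (auto intro!: sum.mono_neutral_left simp: in_keys_iff)
qed

lemma eval_poly_add: "eval_poly (P + Q) A = eval_poly P A + eval_poly Q A"
proof -
  let ?K = "Poly_Mapping.keys P \<union> Poly_Mapping.keys Q"
  have K: "finite ?K" "Poly_Mapping.keys P \<subseteq> ?K" "Poly_Mapping.keys Q \<subseteq> ?K"
    "Poly_Mapping.keys (P + Q) \<subseteq> ?K"
    using Poly_Mapping.keys_add[of P Q] by auto
  show ?thesis
    unfolding eval_poly_superset[OF K(1,2)] eval_poly_superset[OF K(1,3)] eval_poly_superset[OF K(1,4)]
    by (simp add: lookup_add distrib_right sum.distrib)
qed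

lemma eval_poly_zero [simp]: "eval_poly 0 A = 0"
  by (simp add: eval_poly_def)

lemma eval_poly_sum: "eval_poly (sum f K) A = (\<Sum>k\<in>K. eval_poly (f k) A)"
  by (induction K rule: infinite_finite_induct) (simp_all add: eval_poly_add)

lemma eval_poly_single: "eval_poly (Poly_Mapping.single m c) A = of_real c * eval_monomial m A"
  by (subst eval_poly_superset[of "{m}"]) auto

text \<open>
  The coefficient formula makes visible what the definition by a sum over the keys hides:
  partial derivatives commute, and their monomials divide those of the original polynomial.
\<close>

lemma lookup_partial_deriv:
  "Poly_Mapping.lookup (partial_deriv v P) n
     = of_nat (Poly_Mapping.lookup n v + 1) * Poly_Mapping.lookup P (n + Poly_Mapping.single v 1)"
proof -
  let ?e = "Poly_Mapping.single v (1::nat)"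
  have "Poly_Mapping.lookup (partial_deriv v P) n
      = (\<Sum>m\<in>Poly_Mapping.keys P. of_nat (Poly_Mapping.lookup m v) * Poly_Mapping.lookup P m when m - ?e = n)"
    by (simp add: partial_deriv_def lookup_sum lookup_single)
  also have "\<dots> = (\<Sum>m\<in>Poly_Mapping.keys P. if m = n + ?e
        then of_nat (Poly_Mapping.lookup m v) * Poly_Mapping.lookup P m else 0)"
  proof (rule sum.cong)
    fix m
    \<comment> \<open>Truncated subtraction is only invertible when v occurs in m; otherwise both sides vanish.\<close>
    have "m = n + ?e" if n: "m - ?e = n" and v: "Poly_Mapping.lookup m v \<noteq> 0"
    proof (rule poly_mapping_eqI)
      fix w
      show "Poly_Mapping.lookup m w = Poly_Mapping.lookup (n + ?e) w"
        using v by (cases "w = v") (simp_all add: n[symmetric] lookup_add lookup_minus lookup_single)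
    qed
    then have "m - ?e = n \<longleftrightarrow> m = n + ?e" if "Poly_Mapping.lookup m v \<noteq> 0"
      using that add_diff_cancel_right' by blast
    then show "(of_nat (Poly_Mapping.lookup m v) * Poly_Mapping.lookup P m when m - ?e = n)
        = (if m = n + ?e then of_nat (Poly_Mapping.lookup m v) * Poly_Mapping.lookup P m else 0)"
      by (cases "Poly_Mapping.lookup m v = 0")
         (simp_all only: when_def of_nat_0 mult_zero_left if_cancel not_False_eq_True True_implies_equals)
  qed simp
  also have "\<dots> = of_nat (Poly_Mapping.lookup n v + 1) * Poly_Mapping.lookup P (n + ?e)"
    by (subst sum.delta) (simp_all only: finite_keys in_keys_iff lookup_add lookup_single_eq if_split, simp)
  finally show ?thesis .
qed

lemma partial_deriv_commute:
  "partial_deriv v (partial_deriv w P) = partial_deriv w (partial_deriv v P)"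
proof (cases "v = w")
  case False
  show ?thesis
  proof (rule poly_mapping_eqI)
    fix m
    have "m + Poly_Mapping.single w 1 + Poly_Mapping.single v 1
        = m + Poly_Mapping.single v 1 + Poly_Mapping.single w (1::nat)"
      by (simp only: add.assoc add.commute[of "Poly_Mapping.single w 1"])
    moreover have "Poly_Mapping.lookup (m + Poly_Mapping.single w 1) v = Poly_Mapping.lookup m v"
      "Poly_Mapping.lookup (m + Poly_Mapping.single v 1) w = Poly_Mapping.lookup m w"
      using False by (simp_all add: lookup_add lookup_single_not_eq)
    ultimately show "Poly_Mapping.lookup (partial_deriv v (partial_deriv w P)) m
        = Poly_Mapping.lookup (partial_deriv w (partial_deriv v P)) m"
      by (simp only: lookup_partial_deriv mult.left_commute)
  qed
qed simp

abbreviation diag_deriv :: "'n \<Rightarrow> 'n matrix_poly \<Rightarrow> 'n matrix_poly" where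
  "diag_deriv i \<equiv> partial_deriv (i, i)"

text \<open>
  Indexing the iterated derivatives by the set U of differentiated variables, rather than by its
  complement as the restriction does, turns each further derivative into the insertion of an element.
\<close>

abbreviation diag_derivs :: "'n::{finite,linorder} set \<Rightarrow> 'n matrix_poly \<Rightarrow> 'n matrix_poly" where
  "diag_derivs U \<equiv> restriction (- U)"

lemma diag_derivs_empty [simp]: "restriction UNIV P = P"
  by (simp add: restriction_def)

lemma diag_derivs_insert:
  assumes "i \<notin> U"
  shows "diag_derivs (insert i U) P = diag_deriv i (diag_derivs U P)"
proof -
  interpret comp_fun_commute "diag_deriv :: 'a \<Rightarrow> 'a matrix_poly \<Rightarrow> 'a matrix_poly"
    by unfold_locales (auto simp: fun_eq_iff partial_deriv_commute)
  have "diag_derivs V P = Finite_Set.fold diag_deriv P V" for V :: "'a set"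
    using fold_set_fold_remdups[where xs = "sorted_list_of_set V" and y = P]
    by (simp add: restriction_def distinct_remdups_id)
  then show ?thesis
    using assms by simp
qed

section \<open>Polynomials of degree at most one in each diagonal variable\<close>

definition diag_affine :: "'n matrix_poly \<Rightarrow> bool" where
  "diag_affine P \<longleftrightarrow> (\<forall>m\<in>Poly_Mapping.keys P. \<forall>i. Poly_Mapping.lookup m (i, i) \<le> 1)"

lemma diag_affine_deriv:
  assumes "diag_affine P"
  shows "diag_affine (diag_deriv i P)"
  unfolding diag_affine_def
proof (intro ballI allI)
  fix m k
  assume "m \<in> Poly_Mapping.keys (diag_deriv i P)"
  then have "m + Poly_Mapping.single (i, i) 1 \<in> Poly_Mapping.keys P"
    by (auto simp: in_keys_iff lookup_partial_deriv)
  then have "Poly_Mapping.lookup (m + Poly_Mapping.single (i, i) 1) (k, k) \<le> 1"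
    using assms by (auto simp: diag_affine_def)
  then show "Poly_Mapping.lookup m (k, k) \<le> 1"
    by (simp add: lookup_add)
qed

lemma diag_affine_derivs:
  assumes "diag_affine P"
  shows "diag_affine (diag_derivs U P)"
proof -
  have "finite U" by simp
  then show ?thesis
    by (induction U) (simp_all add: diag_derivs_insert diag_affine_deriv assms)
qed

text \<open>
  A diagonal variable occurs in the Leibniz term of a permutation p on J only as the factor of a
  fixed point of p, and each index is the factor of one row only.
\<close>

lemma diag_affine_principal_minor:
  fixes J :: "'n::{finite,linorder} set"
  shows "diag_affine (const_poly c * principal_minor J sym_indets)"
proof -
  let ?e = "\<lambda>g. Poly_Mapping.single (g :: 'n \<times> 'n) (1::nat)"
  let ?g = "\<lambda>p i. (min i (p i), max i (p i) :: 'n)"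
  have term_keys: "(\<Prod>i\<in>K. indet (?g p i) :: 'n matrix_poly) = Poly_Mapping.single (\<Sum>i\<in>K. ?e (?g p i)) 1"
    for p and K :: "'n set"
    by (induction K rule: infinite_finite_induct) (simp_all add: indet_def mult_single)
  have eq: "const_poly c * principal_minor J sym_indets
      = (\<Sum>p | p permutes J. Poly_Mapping.single (\<Sum>i\<in>J. ?e (?g p i)) (c * of_int (sign p)))"
    unfolding principal_minor_def sym_indets_def const_poly_def single_of_int[symmetric]
    by (simp add: term_keys sum_distrib_left mult_single del: single_of_int)
  have bound: "Poly_Mapping.lookup (\<Sum>i\<in>J. ?e (?g p i)) (k, k) \<le> 1" for p k
  proof -
    have "Poly_Mapping.lookup (\<Sum>i\<in>J. ?e (?g p i)) (k, k) = (\<Sum>i\<in>J. if ?g p i = (k, k) then 1 else 0)"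
      by (simp add: lookup_sum lookup_single when_def del: One_nat_def)
    also have "\<dots> \<le> (\<Sum>i\<in>J. if i = k then 1 else 0)"
      by (rule sum_mono) (auto simp: min_def max_def split: if_splits)
    also have "\<dots> \<le> 1"
      by (subst sum.delta) auto
    finally show ?thesis .
  qed
  show ?thesis
    unfolding diag_affine_def eq
  proof (intro ballI allI)
    fix m k
    assume "m \<in> Poly_Mapping.keys (\<Sum>p | p permutes J.
        Poly_Mapping.single (\<Sum>i\<in>J. ?e (?g p i)) (c * of_int (sign p)))"
    from subsetD[OF keys_sum this] obtain p where "m \<in> Poly_Mapping.keys
        (Poly_Mapping.single (\<Sum>i\<in>J. ?e (?g p i)) (c * of_int (sign p)))"
      by (rule UN_E)
    then have "m = (\<Sum>i\<in>J. ?e (?g p i))"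
      by (auto simp only: keys_single split: if_splits)
    then show "Poly_Mapping.lookup m (k, k) \<le> 1"
      using bound by blast
  qed
qed

lemma diag_affine_sum:
  assumes "\<And>k. k \<in> K \<Longrightarrow> diag_affine (f k)"
  shows "diag_affine (sum f K)"
  unfolding diag_affine_def
proof (rule ballI)
  fix m
  assume "m \<in> Poly_Mapping.keys (sum f K)"
  from subsetD[OF keys_sum this] obtain k where "k \<in> K" "m \<in> Poly_Mapping.keys (f k)"
    by (rule UN_E)
  with assms show "\<forall>i. Poly_Mapping.lookup m (i, i) \<le> 1"
    by (simp add: diag_affine_def)
qed

lemma lpm_polynomial_diag_affine: "lpm_polynomial P \<Longrightarrow> diag_affine P"
  unfolding lpm_polynomial_def by (auto intro!: diag_affine_sum diag_affine_principal_minor)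

definition diag_mat :: "('n \<Rightarrow> 'a::zero) \<Rightarrow> 'a ^ 'n ^ 'n" where
  "diag_mat y = (\<chi> i j. if i = j then y i else 0)"

definition bump :: "'n \<Rightarrow> 'a::zero \<Rightarrow> 'a ^ 'n ^ 'n" where
  "bump i s = diag_mat ((\<lambda>_. 0)(i := s))"

lemma bump_component: "bump i s $ k $ l = (if k = i \<and> l = i then s else 0)"
  by (auto simp: bump_def diag_mat_def)

text \<open>
  For exponent 0 or 1 the binomial expansion of the diagonal factor stops at the linear term.
\<close>

lemma eval_monomial_bump:
  assumes "Poly_Mapping.lookup m (i, i) \<le> 1"
  shows "eval_monomial m (A + bump i s)
    = eval_monomial m A + s * (of_nat (Poly_Mapping.lookup m (i, i)) * eval_monomial (m - Poly_Mapping.single (i, i) 1) A)"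
proof -
  let ?R = "\<Prod>v\<in>UNIV - {(i, i)}. (A $ fst v $ snd v) ^ Poly_Mapping.lookup m v"
  have split: "eval_monomial n B = (B $ i $ i) ^ Poly_Mapping.lookup n (i, i)
      * (\<Prod>v\<in>UNIV - {(i, i)}. (B $ fst v $ snd v) ^ Poly_Mapping.lookup n v)"
    for n and B :: "'b ^ 'a ^ 'a"
    unfolding eval_monomial_def by (subst prod.remove[of _ "(i, i)"]) auto
  have "(\<Prod>v\<in>UNIV - {(i, i)}. ((A + bump i s) $ fst v $ snd v) ^ Poly_Mapping.lookup m v) = ?R"
    by (rule prod.cong) (auto simp: bump_component)
  moreover have "(\<Prod>v\<in>UNIV - {(i, i)}. (A $ fst v $ snd v)
      ^ Poly_Mapping.lookup (m - Poly_Mapping.single (i, i) 1) v) = ?R"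
    by (rule prod.cong) (auto simp: lookup_minus lookup_single)
  moreover have "Poly_Mapping.lookup m (i, i) = 0 \<or> Poly_Mapping.lookup m (i, i) = 1"
    using assms by linarith
  ultimately show ?thesis
    by (auto simp: split lookup_minus bump_component distrib_right)
qed

text \<open>
  The identity on which everything rests: the polynomial is affine in each diagonal variable, and
  its slope is the partial derivative. It holds over the complex numbers as well, where
  stability is used.
\<close>

lemma eval_poly_bump:
  assumes "diag_affine P"
  shows "eval_poly P (A + bump i s) = eval_poly P A + s * eval_poly (diag_deriv i P) A"
proof -
  have E: "eval_poly P B = (\<Sum>m\<in>Poly_Mapping.keys P. of_real (Poly_Mapping.lookup P m) * eval_monomial m B)"
    for B :: "'b ^ 'a ^ 'a"
    by (rule eval_poly_superset) auto
  have "eval_poly P (A + bump i s) = (\<Sum>m\<in>Poly_Mapping.keys P. of_real (Poly_Mapping.lookup P m)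
      * (eval_monomial m A + s * (of_nat (Poly_Mapping.lookup m (i, i))
          * eval_monomial (m - Poly_Mapping.single (i, i) 1) A)))"
    unfolding E using assms by (intro sum.cong) (auto simp: diag_affine_def eval_monomial_bump)
  also have "\<dots> = eval_poly P A + s * (\<Sum>m\<in>Poly_Mapping.keys P. of_real (Poly_Mapping.lookup P m)
      * (of_nat (Poly_Mapping.lookup m (i, i)) * eval_monomial (m - Poly_Mapping.single (i, i) 1) A))"
    unfolding E by (simp add: distrib_left sum.distrib sum_distrib_left mult_ac)
  also have "(\<Sum>m\<in>Poly_Mapping.keys P. of_real (Poly_Mapping.lookup P m)
      * (of_nat (Poly_Mapping.lookup m (i, i)) * eval_monomial (m - Poly_Mapping.single (i, i) 1) A))
      = eval_poly (diag_deriv i P) A"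
    by (simp add: partial_deriv_def eval_poly_sum eval_poly_single mult_ac)
  finally show ?thesis .
qed

section \<open>Diagonal perturbations of a matrix\<close>

lemma diag_mat_add: "diag_mat y + diag_mat z = diag_mat (\<lambda>i. y i + z i)"
  for y z :: "'n::finite \<Rightarrow> 'a::comm_ring_1"
  by (simp add: vec_eq_iff diag_mat_def)

lemma mat_eq_diag_mat: "mat t = diag_mat (\<lambda>_. t)"
  by (simp add: mat_def diag_mat_def)

lemma mat_add: "(mat s + mat t :: 'a::comm_ring_1 ^ 'n ^ 'n) = mat (s + t)"
  by (simp add: vec_eq_iff mat_def)

lemma bump_scaleR: "bump i (s :: real) = s *\<^sub>R bump i 1"
  by (simp add: vec_eq_iff bump_component)

lemma mat_scaleR: "(mat t :: real ^ 'n ^ 'n) = t *\<^sub>R mat 1"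
  by (simp add: vec_eq_iff mat_def)

lemma mat_eq_sum_bump: "(mat t :: 'a::comm_ring_1 ^ 'n ^ 'n) = (\<Sum>i\<in>UNIV. bump i t)"
proof -
  have "(\<Sum>i\<in>UNIV. if k = i \<and> l = i then t else 0) = (if k = l then t else 0)" for k l :: 'n
    by (cases "k = l") (auto intro: sum.neutral)
  then show ?thesis
    by (simp add: vec_eq_iff bump_component mat_def)
qed

lemma inner_bump: "x \<bullet> (bump i s *v x) = s * (x $ i)\<^sup>2" for s :: real
proof -
  have "bump i s *v x = axis i (s * x $ i)"
  proof -
    have "(\<Sum>l\<in>UNIV. (if k = i \<and> l = i then s else 0) * x $ l) = (if k = i then s * x $ i else 0)" for k
      by (cases "k = i") (simp_all add: if_distrib[of "\<lambda>u. u * _"] cong: if_cong)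
    then show ?thesis
      by (simp add: vec_eq_iff matrix_vector_mult_def bump_component axis_def)
  qed
  then show ?thesis
    by (simp add: inner_axis power2_eq_square)
qed

lemma mat_mult_vec: "mat t *v x = t *\<^sub>R x" for t :: real
proof -
  have "(\<Sum>l\<in>UNIV. (if k = l then t else 0) * x $ l) = t * x $ k" for k
    by (simp add: if_distrib[of "\<lambda>u. u * _"] cong: if_cong)
  then show ?thesis
    by (simp add: vec_eq_iff matrix_vector_mult_def mat_def)
qed

lemma symmetric_matrix_iff: "symmetric_matrix A \<longleftrightarrow> (\<forall>i j. A $ i $ j = A $ j $ i)"
  by (auto simp: symmetric_matrix_def transpose_def vec_eq_iff)

lemma symmetric_matrix_bump: "symmetric_matrix A \<Longrightarrow> symmetric_matrix (A + bump i s)"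
  for s :: "'a::ab_group_add"
  by (auto simp: symmetric_matrix_iff bump_component)

lemma symmetric_matrix_mat: "symmetric_matrix A \<Longrightarrow> symmetric_matrix (A + mat s)"
  by (auto simp: symmetric_matrix_iff mat_def)

lemma eval_poly_scale:
  assumes "\<And>m. m \<in> Poly_Mapping.keys P \<Longrightarrow> (\<Sum>v\<in>Poly_Mapping.keys m. Poly_Mapping.lookup m v) = d"
  shows "eval_poly P (\<chi> i j. t * A $ i $ j) = t ^ d * eval_poly P A"
  unfolding eval_poly_def sum_distrib_left
proof (rule sum.cong)
  fix m
  assume "m \<in> Poly_Mapping.keys P"
  then have "t ^ d = (\<Prod>v\<in>Poly_Mapping.keys m. t ^ Poly_Mapping.lookup m v)"
    by (simp add: assms power_sum[symmetric])
  then show "of_real (Poly_Mapping.lookup P m)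
      * (\<Prod>v\<in>Poly_Mapping.keys m. (\<chi> i j. t * A $ i $ j) $ fst v $ snd v ^ Poly_Mapping.lookup m v)
    = t ^ d * (of_real (Poly_Mapping.lookup P m)
      * (\<Prod>v\<in>Poly_Mapping.keys m. A $ fst v $ snd v ^ Poly_Mapping.lookup m v))"
    by (simp add: power_mult_distrib prod.distrib mult_ac)
qed simp

lemma tendsto_eval_poly:
  fixes B :: "'a::real_normed_field ^ 'n ^ 'n"
  assumes "(f \<longlongrightarrow> B) F"
  shows "((\<lambda>x. eval_poly P (f x)) \<longlongrightarrow> eval_poly P B) F"
  unfolding eval_poly_def
  by (intro tendsto_sum tendsto_mult tendsto_const tendsto_prod tendsto_power tendsto_vec_nth assms)

lemma eval_poly_of_real:
  "eval_poly P (\<chi> i j. complex_of_real (A $ i $ j)) = complex_of_real (eval_poly P A)"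
  by (simp add: eval_poly_def)

section \<open>Affine functions on the real line\<close>

lemma linear_nonneg_imp_slope_nonneg:
  fixes a b :: real
  assumes "\<And>s. 0 \<le> s \<Longrightarrow> 0 \<le> a + s * b"
  shows "0 \<le> b"
proof (rule ccontr)
  assume "\<not> ?thesis"
  then have "(\<bar>a\<bar> + 1) / (- b) * b = - (\<bar>a\<bar> + 1)" "0 \<le> (\<bar>a\<bar> + 1) / (- b)"
    by (auto simp: field_simps)
  with assms[of "(\<bar>a\<bar> + 1) / (- b)"] show False
    by simp
qed

text \<open>
  Averaging the hypothesis over s and -s removes the linear terms; the quadratic
  coefficients are then compared by letting s tend to infinity.
\<close>

lemma product_of_lines_le_imp_slopes_le:
  fixes a b c d a' b' c' d' :: real
  assumes "\<And>s. (a + s * a') * (d + s * d') \<le> (b + s * b') * (c + s * c')"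
  shows "a' * d' \<le> b' * c'"
proof -
  have "0 \<le> (b * c - a * d) + r * (b' * c' - a' * d')" if "0 \<le> r" for r
  proof -
    have "sqrt r * sqrt r = r"
      using that by simp
    then obtain u where u: "r = u * u"
      by metis
    show ?thesis
      using assms[of u] assms[of "- u"] unfolding u by (simp add: algebra_simps)
  qed
  then have "0 \<le> b' * c' - a' * d'"
    by (rule linear_nonneg_imp_slope_nonneg)
  then show ?thesis
    by simp
qed

section \<open>The Rayleigh inequalities of a stable polynomial\<close>

text \<open>
  For i \<noteq> j and polynomials affine in each diagonal variable this is the strong Rayleigh property of
  stable polynomials, a form of negative correlation. It is the inequality for a pair of sets
  in the case that one variable is differentiated in each, i in one and j in the other.
\<close>

definition rayleigh :: "'n::finite matrix_poly \<Rightarrow> bool" where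
  "rayleigh P \<longleftrightarrow> (\<forall>A :: real ^ 'n ^ 'n. \<forall>i j. symmetric_matrix A \<longrightarrow>
     eval_poly P A * eval_poly (diag_deriv i (diag_deriv j P)) A
       \<le> eval_poly (diag_deriv i P) A * eval_poly (diag_deriv j P) A)"

text \<open>
  Write a, b, c, d for the values at A of P and its derivatives in the i-th, the j-th and both diagonal
  variables. Shifting these variables by s and t gives a + s b + t (c + s d), which vanishes at
  t = - (a + s b) / (c + s d). For s = \<i> the imaginary part of this t has the sign of a d - b c, so
  a d > b c would place a zero of P at a point whose imaginary part is positive in the diagonal entries
  i and j and zero elsewhere; the denominator c + \<i> d is nonzero, as c and d are real and not both 0. This imaginary part is only positive semidefinite;
  since the inequality a d > b c is strict, the zero persists after adding a small multiple
  \<i> \<delta> of the identity to A, where stability forbids it.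
\<close>

lemma psd_stable_imp_rayleigh:
  assumes aff: "diag_affine P" and stable: "psd_stable P"
  shows "rayleigh P"
  unfolding rayleigh_def
proof (intro allI impI, rule ccontr)
  fix A :: "real ^ 'a ^ 'a" and i j
  assume sym: "symmetric_matrix A"
  define a b c d where "a = eval_poly P A" and "b = eval_poly (diag_deriv i P) A"
    and "c = eval_poly (diag_deriv j P) A" and "d = eval_poly (diag_deriv i (diag_deriv j P)) A"
  note abcd = a_def b_def c_def d_def
  assume "\<not> eval_poly P A * eval_poly (diag_deriv i (diag_deriv j P)) A
       \<le> eval_poly (diag_deriv i P) A * eval_poly (diag_deriv j P) A"
  then have gt: "b * c < a * d"
    by (simp add: abcd)
  \<comment> \<open>The zero t for s = \<i> at the matrix shifted by \<i> \<delta> is - num \<delta> / den \<delta>.\<close>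
  define B where "B \<delta> = (\<chi> i j. complex_of_real (A $ i $ j)) + mat (\<i> * complex_of_real \<delta>)" for \<delta>
  define num den where "num \<delta> = eval_poly P (B \<delta>) + \<i> * eval_poly (diag_deriv i P) (B \<delta>)"
    and "den \<delta> = eval_poly (diag_deriv j P) (B \<delta>) + \<i> * eval_poly (diag_deriv i (diag_deriv j P)) (B \<delta>)" for \<delta>
  have B0: "(B \<longlongrightarrow> (\<chi> i j. complex_of_real (A $ i $ j))) (at_right 0)"
  proof (intro vec_tendstoI)
    fix k l
    have "((\<lambda>\<delta>. complex_of_real (A $ k $ l) + (if k = l then \<i> * complex_of_real \<delta> else 0))
        \<longlongrightarrow> complex_of_real (A $ k $ l)) (at_right 0)"
      by (cases "k = l") (auto intro!: tendsto_eq_intros)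
    then show "((\<lambda>\<delta>. B \<delta> $ k $ l) \<longlongrightarrow> (\<chi> i j. complex_of_real (A $ i $ j)) $ k $ l) (at_right 0)"
      by (simp add: B_def mat_def cong: if_cong)
  qed
  have num: "(num \<longlongrightarrow> Complex a b) (at_right 0)" and den: "(den \<longlongrightarrow> Complex c d) (at_right 0)"
    unfolding num_def den_def abcd Complex_eq
    by (intro tendsto_intros tendsto_eval_poly[OF B0, unfolded eval_poly_of_real])+
  have den_nz: "Complex c d \<noteq> 0"
    using gt by (auto simp: complex_eq_iff)
  have Im_pos: "0 < Im (- (Complex a b / Complex c d))"
  proof -
    have "Im (- (Complex a b / Complex c d)) = (a * d - b * c) / (c\<^sup>2 + d\<^sup>2)"
      by (simp add: Im_divide diff_divide_distrib)
    moreover have "0 < c\<^sup>2 + d\<^sup>2"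
      using gt by (auto simp: sum_power2_gt_zero_iff)
    ultimately show ?thesis
      using gt by simp
  qed
  have "((\<lambda>\<delta>. Im (- (num \<delta> / den \<delta>))) \<longlongrightarrow> Im (- (Complex a b / Complex c d))) (at_right 0)"
    by (intro tendsto_intros num den den_nz)
  then have "eventually (\<lambda>\<delta>. 0 < Im (- (num \<delta> / den \<delta>))) (at_right 0)"
    using Im_pos by (rule order_tendstoD)
  moreover have "eventually (\<lambda>\<delta>. den \<delta> \<noteq> 0) (at_right 0)"
    using den den_nz by (rule tendsto_imp_eventually_ne)
  moreover have "eventually (\<lambda>\<delta>::real. 0 < \<delta>) (at_right 0)"
    by (simp add: eventually_at_right_less)
  ultimately have "eventually (\<lambda>\<delta>. 0 < Im (- (num \<delta> / den \<delta>)) \<and> den \<delta> \<noteq> 0 \<and> 0 < \<delta>) (at_right 0)"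
    by (auto elim: eventually_elim2)
  then obtain \<delta> where \<delta>: "0 < Im (- (num \<delta> / den \<delta>))" "den \<delta> \<noteq> 0" "0 < \<delta>"
    using eventually_happens' trivial_limit_at_right_real by blast
  define t where "t = - (num \<delta> / den \<delta>)"
  define Z where "Z = B \<delta> + bump i \<i> + bump j t"
  have "eval_poly P Z = num \<delta> + t * den \<delta>"
    unfolding Z_def num_def den_def
    by (simp add: eval_poly_bump aff diag_affine_deriv)
  then have "eval_poly P Z = 0"
    using \<delta>(2) by (simp add: t_def)
  moreover have "symmetric_matrix Z"
    using sym unfolding Z_def B_def
    by (intro symmetric_matrix_bump symmetric_matrix_mat) (simp add: symmetric_matrix_iff)
  moreover have "positive_definite (\<chi> k l. Im (Z $ k $ l))"
  proof -
    have Im_Z: "(\<chi> k l. Im (Z $ k $ l)) = mat \<delta> + bump i 1 + bump j (Im t)"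
      by (auto simp: Z_def B_def vec_eq_iff mat_def bump_component)
    have "symmetric_matrix (mat \<delta> + bump i 1 + bump j (Im t))"
      by (intro symmetric_matrix_bump) (simp add: symmetric_matrix_iff mat_def)
    moreover have "0 < x \<bullet> ((mat \<delta> + bump i 1 + bump j (Im t)) *v x)" if "x \<noteq> 0" for x
      using that \<delta>(1,3) unfolding t_def[symmetric]
      by (simp add: matrix_vector_mult_add_rdistrib inner_add_right inner_bump mat_mult_vec add_pos_nonneg)
    ultimately show ?thesis
      by (simp add: positive_definite_def Im_Z)
  qed
  ultimately show False
    using stable by (auto simp: psd_stable_def)
qed

text \<open>
  The inequality for P at A, with the k-th diagonal entry shifted by s, compares two
  products of affine functions of s. Its leading coefficients form the inequality for the derivative,
  so the property passes to derivatives without a return to stability.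
\<close>

lemma rayleigh_deriv:
  assumes aff: "diag_affine P" and ray: "rayleigh P"
  shows "rayleigh (diag_deriv k P)"
  unfolding rayleigh_def
proof (intro allI impI)
  fix A :: "real ^ 'a ^ 'a" and i j
  assume sym: "symmetric_matrix A"
  have "eval_poly (diag_deriv k P) A * eval_poly (diag_deriv k (diag_deriv i (diag_deriv j P))) A
      \<le> eval_poly (diag_deriv k (diag_deriv i P)) A * eval_poly (diag_deriv k (diag_deriv j P)) A"
  proof (rule product_of_lines_le_imp_slopes_le)
    fix s
    have "eval_poly P (A + bump k s) * eval_poly (diag_deriv i (diag_deriv j P)) (A + bump k s)
       \<le> eval_poly (diag_deriv i P) (A + bump k s) * eval_poly (diag_deriv j P) (A + bump k s)"
      using ray symmetric_matrix_bump[OF sym] by (auto simp: rayleigh_def)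
    then show "(eval_poly P A + s * eval_poly (diag_deriv k P) A)
        * (eval_poly (diag_deriv i (diag_deriv j P)) A
           + s * eval_poly (diag_deriv k (diag_deriv i (diag_deriv j P))) A)
      \<le> (eval_poly (diag_deriv i P) A + s * eval_poly (diag_deriv k (diag_deriv i P)) A)
        * (eval_poly (diag_deriv j P) A + s * eval_poly (diag_deriv k (diag_deriv j P)) A)"
      by (simp add: eval_poly_bump aff diag_affine_deriv)
  qed
  then show "eval_poly (diag_deriv k P) A * eval_poly (diag_deriv i (diag_deriv j (diag_deriv k P))) A
      \<le> eval_poly (diag_deriv i (diag_deriv k P)) A * eval_poly (diag_deriv j (diag_deriv k P)) A"
    by (simp only: partial_deriv_commute[of "(i, i)" "(k, k)"] partial_deriv_commute[of "(j, j)" "(k, k)"])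
qed

lemma rayleigh_derivs:
  assumes "diag_affine P" "rayleigh P"
  shows "rayleigh (diag_derivs U P)"
proof -
  have "finite U" by simp
  then show ?thesis
    by (induction U) (simp_all add: diag_derivs_insert rayleigh_deriv diag_affine_derivs assms)
qed

section \<open>Positivity over the interior of the hyperbolicity cone\<close>

lemma eval_poly_differentiable:
  "(\<lambda>A :: real ^ 'n ^ 'n. eval_poly P A) differentiable (at B)"
proof -
  have lin: "(\<lambda>A :: real ^ 'n ^ 'n. A $ k $ l) differentiable (at B)" for k l
    by (rule bounded_linear_imp_differentiable)
       (intro bounded_linear_compose[OF bounded_linear_vec_nth] bounded_linear_vec_nth)
  have "(\<lambda>A :: real ^ 'n ^ 'n. \<Prod>v\<in>K. (A $ fst v $ snd v) ^ e v) differentiable (at B)"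
    if "finite K" for K and e :: "'n \<times> 'n \<Rightarrow> nat"
    using that
  proof induction
    case (insert v K)
    then show ?case
      unfolding prod.insert[OF insert.hyps] by (intro differentiable_mult differentiable_power lin)
  qed simp
  then show ?thesis
    unfolding eval_poly_def by (intro differentiable_sum differentiable_mult differentiable_const) auto
qed

text \<open>
  The identity matrix is the sum of the diagonal units, so the derivative along it is the sum of
  the diagonal partial derivatives.
\<close>

lemma eval_poly_deriv_identity:
  fixes A :: "real ^ 'n ^ 'n"
  assumes aff: "diag_affine P"
  shows "((\<lambda>t. eval_poly P (A + mat t)) has_real_derivative
     (\<Sum>i\<in>UNIV. eval_poly (diag_deriv i P) (A + mat t))) (at t)"
proof -
  let ?B = "A + mat t"
  obtain D where D: "((\<lambda>M. eval_poly P M) has_derivative D) (at ?B)"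
    using eval_poly_differentiable by (auto simp: differentiable_def)
  interpret D: bounded_linear D
    using D by (rule has_derivative_bounded_linear)
  have D_bump: "D (bump i 1) = eval_poly (diag_deriv i P) ?B" for i
  proof -
    have "((\<lambda>s. eval_poly P (?B + s *\<^sub>R bump i 1)) has_derivative (\<lambda>s. D (s *\<^sub>R bump i 1))) (at 0)"
      by (rule has_derivative_compose[where f = "\<lambda>s. ?B + s *\<^sub>R bump i 1"])
         (auto intro!: derivative_eq_intros D)
    moreover have "((\<lambda>s. eval_poly P (?B + s *\<^sub>R bump i 1)) has_derivative
        (\<lambda>s. s * eval_poly (diag_deriv i P) ?B)) (at 0)"
      unfolding bump_scaleR[symmetric] eval_poly_bump[OF aff] by (auto intro!: derivative_eq_intros)
    ultimately have "(\<lambda>s. D (s *\<^sub>R bump i 1)) = (\<lambda>s. s * eval_poly (diag_deriv i P) ?B)"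
      by (rule has_derivative_unique)
    from fun_cong[OF this, of 1] show ?thesis
      by simp
  qed
  have "((\<lambda>t. eval_poly P (A + t *\<^sub>R mat 1)) has_derivative (\<lambda>s. D (s *\<^sub>R mat 1))) (at t)"
    by (rule has_derivative_compose[where f = "\<lambda>t. A + t *\<^sub>R mat 1"])
       (auto intro!: derivative_eq_intros D[unfolded mat_scaleR[of t]])
  moreover have "D (s *\<^sub>R mat 1) = (\<Sum>i\<in>UNIV. eval_poly (diag_deriv i P) ?B) * s" for s
    by (simp add: D.scaleR mat_eq_sum_bump D.sum D_bump)
  ultimately show ?thesis
    by (simp add: has_field_derivative_def mat_scaleR[symmetric])
qed

text \<open>
  Stability gives a nonzero value at \<i> I, and homogeneity turns it into a nonzero multiple of the
  value at I.
\<close>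

lemma psd_stable_homogeneous_identity:
  assumes "psd_stable P" "homogeneous P"
  shows "eval_poly P (mat 1 :: real ^ 'n ^ 'n) \<noteq> 0"
proof
  assume zero: "eval_poly P (mat 1 :: real ^ 'n ^ 'n) = 0"
  let ?I = "\<chi> i j. complex_of_real ((mat 1 :: real ^ 'n ^ 'n) $ i $ j)"
  let ?Z = "\<chi> i j. \<i> * ?I $ i $ j"
  obtain d where "\<And>m. m \<in> Poly_Mapping.keys P \<Longrightarrow>
      (\<Sum>v\<in>Poly_Mapping.keys m. Poly_Mapping.lookup m v) = d"
    using assms(2) by (auto simp: homogeneous_def)
  then have "eval_poly P ?Z = \<i> ^ d * eval_poly P ?I"
    by (rule eval_poly_scale)
  then have "eval_poly P ?Z = 0"
    by (simp only: eval_poly_of_real zero of_real_0 mult_zero_right)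
  moreover have "symmetric_matrix ?Z"
    by (simp add: symmetric_matrix_iff mat_def)
  moreover have "positive_definite (\<chi> i j. Im (?Z $ i $ j))"
  proof -
    have "(\<chi> i j. Im (?Z $ i $ j)) = mat 1"
      by (simp add: vec_eq_iff mat_def)
    then show ?thesis
      by (simp add: positive_definite_def symmetric_matrix_def transpose_mat)
  qed
  ultimately show False
    using assms(1) by (auto simp: psd_stable_def)
qed

text \<open>
  The derivative has smaller degree than P. This is made precise without expanding in t: by
  homogeneity P (M + t I) is t ^ d times P (I + M / t), and the derivative is the difference of two
  such values, which both have the limit P (I) after division by t ^ d.
\<close>

lemma diag_affine_deriv_ratio_tendsto_0:
  fixes A :: "real ^ 'n ^ 'n"
  assumes aff: "diag_affine P" and hom: "homogeneous P"
    and nz: "eval_poly P (mat 1 :: real ^ 'n ^ 'n) \<noteq> 0"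
  shows "((\<lambda>t. eval_poly (diag_deriv i P) (A + mat t) / eval_poly P (A + mat t)) \<longlongrightarrow> 0) at_top"
proof -
  obtain d where d: "\<And>m. m \<in> Poly_Mapping.keys P \<Longrightarrow>
      (\<Sum>v\<in>Poly_Mapping.keys m. Poly_Mapping.lookup m v) = d"
    using hom by (auto simp: homogeneous_def)
  define G where "G M t = eval_poly P (mat 1 + inverse t *\<^sub>R M)" for M :: "real ^ 'n ^ 'n" and t :: real
  have G: "(G M \<longlongrightarrow> eval_poly P (mat 1)) at_top" for M
  proof -
    have "((\<lambda>t. mat 1 + inverse t *\<^sub>R M) \<longlongrightarrow> mat 1 + 0 *\<^sub>R M) at_top"
      by (intro tendsto_intros tendsto_inverse_0_at_top filterlim_ident)
    then show ?thesis
      unfolding G_def by (intro tendsto_eval_poly) simp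
  qed
  have scale: "eval_poly P (M + mat t) = t ^ d * G M t" if "0 < t" for M t
  proof -
    have "M + mat t = (\<chi> i j. t * (mat 1 + inverse t *\<^sub>R M) $ i $ j)"
      using that by (simp add: vec_eq_iff mat_def field_simps)
    then show ?thesis
      unfolding G_def using eval_poly_scale[OF d] by metis
  qed
  have ratio: "eval_poly (diag_deriv i P) (A + mat t) / eval_poly P (A + mat t)
      = (G (A + bump i 1) t - G A t) / G A t" if "0 < t" for t
  proof -
    have "eval_poly (diag_deriv i P) (A + mat t) = eval_poly P (A + bump i 1 + mat t) - eval_poly P (A + mat t)"
      using eval_poly_bump[OF aff, of "A + mat t" i 1] by (simp add: add_ac)
    also have "\<dots> = t ^ d * (G (A + bump i 1) t - G A t)"
      by (simp add: scale that right_diff_distrib)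
    finally show ?thesis
      using that by (simp add: scale)
  qed
  have "((\<lambda>t. (G (A + bump i 1) t - G A t) / G A t) \<longlongrightarrow>
      (eval_poly P (mat 1) - eval_poly P (mat 1)) / eval_poly P (mat 1)) at_top"
    by (intro tendsto_intros G nz)
  then have "((\<lambda>t. (G (A + bump i 1) t - G A t) / G A t) \<longlongrightarrow> 0) at_top"
    by simp
  moreover have "eventually (\<lambda>t. (G (A + bump i 1) t - G A t) / G A t
      = eval_poly (diag_deriv i P) (A + mat t) / eval_poly P (A + mat t)) at_top"
    using eventually_gt_at_top[of 0] by eventually_elim (simp add: ratio)
  ultimately show ?thesis
    by (rule Lim_transform_eventually)
qed

text \<open>
  The defining property of an interior point of the hyperbolicity cone in terms of real values only: no
  zero, hence a constant sign \<open>\<sigma>\<close>, along the ray in the direction of the identity.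
\<close>

definition positive_ray :: "real \<Rightarrow> 'n::finite matrix_poly \<Rightarrow> real ^ 'n ^ 'n \<Rightarrow> bool" where
  "positive_ray \<sigma> P A \<longleftrightarrow> symmetric_matrix A \<and> (\<forall>t\<ge>0. 0 < \<sigma> * eval_poly P (A + mat t))"

lemma positive_ray_start: "positive_ray \<sigma> P A \<Longrightarrow> 0 < \<sigma> * eval_poly P A"
  unfolding positive_ray_def by (metis add_0_right mat_0 order_refl)

lemma positive_ray_mat:
  assumes "positive_ray \<sigma> P A" "0 \<le> t"
  shows "positive_ray \<sigma> P (A + mat t)"
  using assms by (auto simp: positive_ray_def symmetric_matrix_mat add.assoc mat_add)

text \<open>
  Along the ray A + t I the quotient of the derivative by P is nonincreasing: the numerator of its
  derivative is a sum over j of the differences that the Rayleigh inequalities bound by 0. As the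
  quotient tends to 0 at infinity, it is nonnegative at t = 0.
\<close>

lemma positive_ray_diag_deriv_nonneg:
  fixes A :: "real ^ 'n ^ 'n"
  assumes aff: "diag_affine P" and ray: "rayleigh P" and hom: "homogeneous P"
    and nz: "eval_poly P (mat 1 :: real ^ 'n ^ 'n) \<noteq> 0"
    and pos: "positive_ray \<sigma> P A"
  shows "0 \<le> \<sigma> * eval_poly (diag_deriv i P) A"
proof -
  let ?p = "\<lambda>t. eval_poly P (A + mat t)"
  let ?q = "\<lambda>t. eval_poly (diag_deriv i P) (A + mat t)"
  have p_nz: "?p t \<noteq> 0" if "0 \<le> t" for t
    using pos that by (force simp: positive_ray_def)
  have decreasing: "?q t / ?p t \<le> ?q 0 / ?p 0" if "0 \<le> t" for t
  proof (rule DERIV_nonpos_imp_nonincreasing[OF that])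
    fix s :: real
    assume "0 \<le> s"
    let ?B = "A + mat s"
    have "((\<lambda>t. ?q t / ?p t) has_real_derivative
        ((\<Sum>j\<in>UNIV. eval_poly (diag_deriv j (diag_deriv i P)) ?B) * ?p s
          - ?q s * (\<Sum>j\<in>UNIV. eval_poly (diag_deriv j P) ?B)) / (?p s * ?p s)) (at s)"
      by (intro DERIV_divide eval_poly_deriv_identity aff diag_affine_deriv p_nz \<open>0 \<le> s\<close>)
    moreover have "(\<Sum>j\<in>UNIV. eval_poly (diag_deriv j (diag_deriv i P)) ?B) * ?p s
        \<le> ?q s * (\<Sum>j\<in>UNIV. eval_poly (diag_deriv j P) ?B)"
      unfolding sum_distrib_left sum_distrib_right
      using ray symmetric_matrix_mat[of A s] pos
      by (intro sum_mono) (simp add: rayleigh_def positive_ray_def mult.commute)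
    ultimately show "\<exists>y. ((\<lambda>t. ?q t / ?p t) has_real_derivative y) (at s) \<and> y \<le> 0"
      by (intro exI conjI) (auto intro: divide_nonpos_nonneg)
  qed
  have "0 \<le> ?q 0 / ?p 0"
    using diag_affine_deriv_ratio_tendsto_0[OF aff hom nz, of i A]
  proof (rule tendsto_upperbound)
    show "eventually (\<lambda>t. ?q t / ?p t \<le> ?q 0 / ?p 0) at_top"
      using eventually_ge_at_top[of 0] by eventually_elim (rule decreasing)
  qed simp
  moreover have "0 \<le> \<sigma> * ?p 0"
    using positive_ray_start[OF pos] by (simp add: mat_0)
  ultimately have "0 \<le> \<sigma> * ?p 0 * (?q 0 / ?p 0)"
    by (rule mult_nonneg_nonneg[rotated])
  also have "\<dots> = \<sigma> * ?q 0"
    using p_nz[of 0] by simp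
  finally show ?thesis
    by (simp add: mat_0)
qed

text \<open>
  The slope in the i-th diagonal variable has the sign of P all along the ray, so increasing this
  variable never moves the values on the ray towards 0.
\<close>

lemma positive_ray_bump:
  fixes A :: "real ^ 'n ^ 'n"
  assumes aff: "diag_affine P" and ray: "rayleigh P" and hom: "homogeneous P"
    and nz: "eval_poly P (mat 1 :: real ^ 'n ^ 'n) \<noteq> 0"
    and pos: "positive_ray \<sigma> P A" and s: "0 \<le> s"
  shows "positive_ray \<sigma> P (A + bump i s)"
  unfolding positive_ray_def
proof (intro conjI allI impI)
  show "symmetric_matrix (A + bump i s)"
    using pos by (simp add: positive_ray_def symmetric_matrix_bump)
  fix t :: real
  assume t: "0 \<le> t"
  have "eval_poly P (A + bump i s + mat t) = eval_poly P (A + mat t) + s * eval_poly (diag_deriv i P) (A + mat t)"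
    using eval_poly_bump[OF aff, of "A + mat t" i s] by (simp add: add_ac)
  moreover have "0 < \<sigma> * eval_poly P (A + mat t)"
    using pos t by (simp add: positive_ray_def)
  moreover have "0 \<le> s * (\<sigma> * eval_poly (diag_deriv i P) (A + mat t))"
    using positive_ray_diag_deriv_nonneg[OF aff ray hom nz positive_ray_mat[OF pos t]] s by simp
  ultimately show "0 < \<sigma> * eval_poly P (A + bump i s + mat t)"
    by (simp add: distrib_left mult.left_commute)
qed

lemma positive_ray_diag:
  fixes A :: "real ^ 'n ^ 'n"
  assumes aff: "diag_affine P" and ray: "rayleigh P" and hom: "homogeneous P"
    and nz: "eval_poly P (mat 1 :: real ^ 'n ^ 'n) \<noteq> 0"
    and pos: "positive_ray \<sigma> P A" and y: "\<And>i. 0 \<le> y i"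
  shows "positive_ray \<sigma> P (A + diag_mat y)"
proof -
  have "positive_ray \<sigma> P (A + diag_mat (\<lambda>i. if i \<in> U then y i else 0))" if "finite U" for U
    using that
  proof induction
    case empty
    have "A + diag_mat (\<lambda>i. 0) = A"
      by (simp add: vec_eq_iff diag_mat_def)
    then show ?case
      using pos by simp
  next
    case (insert k U)
    have "A + diag_mat (\<lambda>i. if i \<in> insert k U then y i else 0)
        = A + diag_mat (\<lambda>i. if i \<in> U then y i else 0) + bump k (y k)"
      using insert.hyps by (auto simp: vec_eq_iff diag_mat_def bump_component)
    then show ?case
      using positive_ray_bump[OF aff ray hom nz insert.IH y] by (simp only:)
  qed
  from this[of UNIV] show ?thesis
    by simp
qed

text \<open>
  A zero of P at A + t I with t > 0 would be a negative root -t. By continuity P has a constant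
  sign on the open ray. This sign may be negative and is therefore carried along as \<open>\<sigma>\<close>.
\<close>

lemma hyperbolicity_cone_sign:
  fixes A :: "real ^ 'n ^ 'n"
  assumes "A \<in> hyperbolicity_cone P"
  obtains \<sigma> :: real where "\<sigma> * \<sigma> = 1" "\<And>\<epsilon>. 0 < \<epsilon> \<Longrightarrow> positive_ray \<sigma> P (A + mat \<epsilon>)"
proof -
  let ?p = "\<lambda>t. eval_poly P (A + mat t)"
  have nz: "?p t \<noteq> 0" if "0 < t" for t
  proof
    assume "?p t = 0"
    moreover have "(\<chi> i j. complex_of_real ((A + mat t) $ i $ j))
        = (\<chi> i j. complex_of_real (A $ i $ j)) - mat (- complex_of_real t)"
      by (simp add: vec_eq_iff mat_def)
    ultimately have "eval_poly P ((\<chi> i j. complex_of_real (A $ i $ j)) - mat (- complex_of_real t)) = 0"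
      using eval_poly_of_real[of P "A + mat t"] by simp
    then have "- complex_of_real t \<in> \<real>\<^sub>\<ge>\<^sub>0"
      using assms by (auto simp: hyperbolicity_cone_def)
    then show False
      using that by (simp add: complex_nonneg_Reals_iff)
  qed
  define \<sigma> where "\<sigma> = sgn (?p 1)"
  have \<sigma>: "\<sigma> * \<sigma> = 1"
    using nz[of 1] by (simp add: \<sigma>_def sgn_if)
  have "0 < \<sigma> * ?p t" if "0 < t" for t
  proof (rule ccontr)
    assume neg: "\<not> 0 < \<sigma> * ?p t"
    \<comment> \<open>By the intermediate value property, a change of sign on the open ray would produce a zero.\<close>
    have "((\<lambda>t. A + t *\<^sub>R mat 1) \<longlongrightarrow> A + s *\<^sub>R mat 1) (at s within {0<..})" for s :: real
      by (intro tendsto_intros)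
    then have "((\<lambda>t. A + mat t) \<longlongrightarrow> A + mat s) (at s within {0<..})" for s :: real
      unfolding mat_scaleR[symmetric] .
    then have "continuous_on {0<..} (\<lambda>t. \<sigma> * ?p t)"
      unfolding continuous_on_def by (intro ballI tendsto_mult tendsto_const tendsto_eval_poly)
    then have "connected ((\<lambda>t. \<sigma> * ?p t) ` {0<..})"
      by (rule connected_continuous_image) simp
    moreover have "0 \<le> \<sigma> * ?p 1"
      by (simp add: \<sigma>_def sgn_if)
    moreover have "\<sigma> * ?p t \<in> (\<lambda>t. \<sigma> * ?p t) ` {0<..}" "\<sigma> * ?p 1 \<in> (\<lambda>t. \<sigma> * ?p t) ` {0<..}"
      using that by (blast intro: imageI greaterThan_iff[THEN iffD2] zero_less_one)+
    ultimately have "0 \<in> (\<lambda>t. \<sigma> * ?p t) ` {0<..}"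
      using neg by (meson connectedD_interval linorder_not_less)
    then show False
      using nz \<sigma> by auto
  qed
  then have "positive_ray \<sigma> P (A + mat \<epsilon>)" if "0 < \<epsilon>" for \<epsilon>
    using assms that by (auto simp: positive_ray_def hyperbolicity_cone_def symmetric_matrix_mat add.assoc mat_add)
  with \<sigma> show ?thesis
    by (rule that)
qed

section \<open>Nonnegativity of all diagonal derivatives\<close>

definition orthant_nonneg :: "real \<Rightarrow> 'n::finite matrix_poly \<Rightarrow> real ^ 'n ^ 'n \<Rightarrow> bool" where
  "orthant_nonneg \<sigma> P A \<longleftrightarrow> (\<forall>y. (\<forall>i. 0 \<le> y i) \<longrightarrow> 0 \<le> \<sigma> * eval_poly P (A + diag_mat y))"

text \<open>
  An affine function that is nonnegative for all s \<ge> 0 has nonnegative slope.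
\<close>

lemma orthant_nonneg_deriv:
  assumes aff: "diag_affine P" and nonneg: "orthant_nonneg \<sigma> P A"
  shows "orthant_nonneg \<sigma> (diag_deriv i P) A"
  unfolding orthant_nonneg_def
proof (intro allI impI)
  fix y :: "'a \<Rightarrow> real"
  assume y: "\<forall>i. 0 \<le> y i"
  have "0 \<le> \<sigma> * eval_poly P (A + diag_mat y) + s * (\<sigma> * eval_poly (diag_deriv i P) (A + diag_mat y))"
    if s: "0 \<le> s" for s
  proof -
    have "A + diag_mat y + bump i s = A + diag_mat (\<lambda>k. y k + ((\<lambda>_. 0)(i := s)) k)"
      unfolding bump_def add.assoc diag_mat_add ..
    moreover have "0 \<le> \<sigma> * eval_poly P (A + diag_mat (\<lambda>k. y k + ((\<lambda>_. 0)(i := s)) k))"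
      using nonneg y s by (simp add: orthant_nonneg_def)
    ultimately have "0 \<le> \<sigma> * eval_poly P (A + diag_mat y + bump i s)"
      by (simp only:)
    then show ?thesis
      by (simp add: eval_poly_bump aff distrib_left mult.left_commute)
  qed
  then show "0 \<le> \<sigma> * eval_poly (diag_deriv i P) (A + diag_mat y)"
    by (rule linear_nonneg_imp_slope_nonneg)
qed

lemma orthant_nonneg_derivs:
  assumes "diag_affine P" "orthant_nonneg \<sigma> P A"
  shows "orthant_nonneg \<sigma> (diag_derivs U P) A"
proof -
  have "finite U" by simp
  then show ?thesis
    by (induction U) (simp_all add: diag_derivs_insert orthant_nonneg_deriv diag_affine_derivs assms)
qed

text \<open>
  All slopes are nonnegative on the shifted orthant, so the coordinates can be increased one at a
  time.
\<close>

lemma orthant_nonneg_mono: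
  assumes aff: "diag_affine P" and nonneg: "orthant_nonneg \<sigma> P A"
    and y: "\<And>i. 0 \<le> y i" and z: "\<And>i. 0 \<le> z i"
  shows "\<sigma> * eval_poly P (A + diag_mat y) \<le> \<sigma> * eval_poly P (A + diag_mat (\<lambda>i. y i + z i))"
proof -
  let ?w = "\<lambda>U i. y i + (if i \<in> U then z i else 0)"
  have "\<sigma> * eval_poly P (A + diag_mat y) \<le> \<sigma> * eval_poly P (A + diag_mat (?w U))" if "finite U" for U
    using that
  proof induction
    case (insert k U)
    have shift: "A + diag_mat (?w (insert k U)) = A + diag_mat (?w U) + bump k (z k)"
      using insert.hyps by (auto simp: vec_eq_iff diag_mat_def bump_component)
    have "0 \<le> z k * (\<sigma> * eval_poly (diag_deriv k P) (A + diag_mat (?w U)))"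
      using orthant_nonneg_deriv[OF aff nonneg, of k] y z by (simp add: orthant_nonneg_def)
    then show ?case
      using insert.IH unfolding shift by (simp add: eval_poly_bump aff distrib_left mult.left_commute)
  qed simp
  from this[of UNIV] show ?thesis
    by simp
qed

text \<open>
  A positive derivative over W is the slope, in an earlier variable k, of the derivative over
  W - {k}; hence after a positive shift of all diagonal entries the latter is positive too. Descending
  from W to U, half of the shift is spent on making the next derivative positive and the other
  half on the k-th entry; the remaining entries follow by monotonicity.
\<close>

lemma orthant_nonneg_derivs_pos:
  assumes aff: "diag_affine P" and nonneg: "orthant_nonneg \<sigma> P A"
    and pos: "0 < \<sigma> * eval_poly (diag_derivs W P) A" and sub: "U \<subseteq> W" and \<epsilon>: "0 < \<epsilon>"
  shows "0 < \<sigma> * eval_poly (diag_derivs U P) (A + mat \<epsilon>)"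
proof -
  have "U \<subseteq> W \<longrightarrow> (\<forall>\<epsilon>>0. 0 < \<sigma> * eval_poly (diag_derivs U P) (A + mat \<epsilon>))"
  proof (induction "card (W - U)" arbitrary: U)
    case 0
    show ?case
    proof (intro impI allI)
      fix \<epsilon> :: real
      assume "U \<subseteq> W" "0 < \<epsilon>"
      with 0 have "U = W"
        by auto
      have "A + diag_mat (\<lambda>_. 0) = A"
        by (simp add: vec_eq_iff diag_mat_def)
      then show "0 < \<sigma> * eval_poly (diag_derivs U P) (A + mat \<epsilon>)"
        using orthant_nonneg_mono[OF diag_affine_derivs[OF aff] orthant_nonneg_derivs[OF aff nonneg],
            of "\<lambda>_. 0" "\<lambda>_. \<epsilon>" U] pos \<open>0 < \<epsilon>\<close> \<open>U = W\<close>
        by (simp add: mat_eq_diag_mat)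
    qed
  next
    case (Suc n)
    show ?case
    proof (intro impI allI)
      fix \<epsilon> :: real
      assume "U \<subseteq> W" "0 < \<epsilon>"
      obtain k where k: "k \<in> W" "k \<notin> U"
        using Suc.hyps(2) by (metis DiffE card.empty ex_in_conv nat.distinct(1))
      then have "W - U = insert k (W - insert k U)"
        by auto
      then have "card (W - insert k U) = n"
        using Suc.hyps(2) by simp
      then have "0 < \<sigma> * eval_poly (diag_derivs (insert k U) P) (A + mat (\<epsilon> / 2))"
        using Suc.hyps(1)[of "insert k U"] k \<open>U \<subseteq> W\<close> \<open>0 < \<epsilon>\<close> by simp
      then have "0 < \<epsilon> / 2 * (\<sigma> * eval_poly (diag_deriv k (diag_derivs U P)) (A + mat (\<epsilon> / 2)))"
        using k \<open>0 < \<epsilon>\<close> by (simp add: diag_derivs_insert)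
      moreover have "0 \<le> \<sigma> * eval_poly (diag_derivs U P) (A + mat (\<epsilon> / 2))"
        using orthant_nonneg_derivs[OF aff nonneg, of U] \<open>0 < \<epsilon>\<close>
        by (simp add: orthant_nonneg_def mat_eq_diag_mat)
      ultimately have "0 < \<sigma> * eval_poly (diag_derivs U P) (A + mat (\<epsilon> / 2) + bump k (\<epsilon> / 2))"
        by (simp add: eval_poly_bump diag_affine_derivs aff distrib_left mult.left_commute)
      also have "A + mat (\<epsilon> / 2) + bump k (\<epsilon> / 2) = A + diag_mat (\<lambda>i. if i = k then \<epsilon> else \<epsilon> / 2)"
        by (auto simp: vec_eq_iff mat_def bump_component diag_mat_def)
      also have "\<sigma> * eval_poly (diag_derivs U P) (A + diag_mat (\<lambda>i. if i = k then \<epsilon> else \<epsilon> / 2))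
          \<le> \<sigma> * eval_poly (diag_derivs U P) (A + diag_mat
              (\<lambda>i. (if i = k then \<epsilon> else \<epsilon> / 2) + (if i = k then 0 else \<epsilon> / 2)))"
        using \<open>0 < \<epsilon>\<close>
        by (intro orthant_nonneg_mono diag_affine_derivs aff orthant_nonneg_derivs nonneg) auto
      also have "(\<lambda>i. (if i = k then \<epsilon> else \<epsilon> / 2) + (if i = k then 0 else \<epsilon> / 2)) = (\<lambda>_. \<epsilon>)"
        by auto
      finally show "0 < \<sigma> * eval_poly (diag_derivs U P) (A + mat \<epsilon>)"
        by (simp add: mat_eq_diag_mat)
    qed
  qed
  then show ?thesis
    using sub \<epsilon> by blast
qed

section \<open>From pairs of indices to pairs of sets\<close>

text \<open>
  For positive g the local inequality says that the factor g (U \<union> {k}) / g (U) decreases as U grows.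
  This passes from single elements to sets by telescoping. Positivity on all subsets of W is what permits
  the cancellations: with zeros allowed, the local inequality would not imply the global one.
\<close>

lemma log_submodular_of_local:
  fixes g :: "'a set \<Rightarrow> real"
  assumes pos: "\<And>U. U \<subseteq> W \<Longrightarrow> 0 < g U"
    and local: "\<And>U i j. i \<notin> U \<Longrightarrow> j \<notin> U \<Longrightarrow> i \<noteq> j \<Longrightarrow> insert i (insert j U) \<subseteq> W \<Longrightarrow>
      g U * g (insert i (insert j U)) \<le> g (insert i U) * g (insert j U)"
    and fin: "finite W" and "X \<subseteq> W" "Y \<subseteq> W"
  shows "g (X \<inter> Y) * g (X \<union> Y) \<le> g X * g Y"
proof -
  \<comment> \<open>The factor gained by adding k to M is at least the one gained by adding k to the larger M \<union> Z.\<close>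
  have add_one: "g M * g (insert k (M \<union> Z)) \<le> g (insert k M) * g (M \<union> Z)"
    if "finite Z" "Z \<inter> M = {}" "k \<notin> M \<union> Z" "insert k (M \<union> Z) \<subseteq> W" for k M Z
    using that
  proof induction
    case (insert l Z)
    let ?N = "M \<union> Z"
    have IH: "g M * g (insert k ?N) \<le> g (insert k M) * g ?N"
      using insert by auto
    have "g ?N * g (insert k (insert l ?N)) \<le> g (insert k ?N) * g (insert l ?N)"
      using insert by (intro local) auto
    then have "g M * (g ?N * g (insert k (insert l ?N))) \<le> g M * (g (insert k ?N) * g (insert l ?N))"
      using pos[of M] insert.prems by (intro mult_left_mono) auto
    also have "\<dots> \<le> g (insert k M) * g ?N * g (insert l ?N)"
      using mult_right_mono[OF IH, of "g (insert l ?N)"] pos[of "insert l ?N"] insert.prems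
      by (simp add: mult.assoc)
    finally have "g ?N * (g M * g (insert k (insert l ?N))) \<le> g ?N * (g (insert k M) * g (insert l ?N))"
      by (simp add: mult_ac)
    then show ?case
      using pos[of ?N] insert.prems by simp
  qed simp
  \<comment> \<open>The elements of Z are added to M and to Y simultaneously, one at a time.\<close>
  have add_set: "g M * g (Y \<union> Z) \<le> g (M \<union> Z) * g Y"
    if "finite Z" "Z \<inter> Y = {}" "M \<subseteq> Y" "Y \<union> Z \<subseteq> W" for M Z
    using that
  proof induction
    case (insert k Z)
    have IH: "g M * g (Y \<union> Z) \<le> g (M \<union> Z) * g Y"
      using insert by auto
    have N: "M \<union> Z \<union> (Y - M) = Y \<union> Z"
      using insert.prems by auto
    have "g (M \<union> Z) * g (insert k (M \<union> Z \<union> (Y - M))) \<le> g (insert k (M \<union> Z)) * g (M \<union> Z \<union> (Y - M))"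
      using insert finite_subset[OF \<open>Y \<subseteq> W\<close> fin] by (intro add_one) auto
    then have step: "g (M \<union> Z) * g (insert k (Y \<union> Z)) \<le> g (insert k (M \<union> Z)) * g (Y \<union> Z)"
      by (simp only: N)
    have "g M * (g (M \<union> Z) * g (insert k (Y \<union> Z))) \<le> g M * (g (insert k (M \<union> Z)) * g (Y \<union> Z))"
      using insert.prems by (intro mult_left_mono step less_imp_le[OF pos]) auto
    also have "\<dots> \<le> g (insert k (M \<union> Z)) * (g (M \<union> Z) * g Y)"
      using mult_left_mono[OF IH, of "g (insert k (M \<union> Z))"] pos[of "insert k (M \<union> Z)"] insert.prems
      by (simp add: mult.left_commute subset_iff)
    finally have "g (M \<union> Z) * (g M * g (insert k (Y \<union> Z))) \<le> g (M \<union> Z) * (g (insert k (M \<union> Z)) * g Y)"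
      by (simp add: mult_ac)
    moreover have "0 < g (M \<union> Z)"
      using insert.prems by (intro pos) auto
    ultimately show ?case
      by simp
  qed simp
  have "X \<inter> Y \<union> (X - Y) = X" "Y \<union> (X - Y) = X \<union> Y" "(X - Y) \<inter> Y = {}"
    by auto
  then show ?thesis
    using add_set[of "X - Y" "X \<inter> Y"] finite_subset[OF \<open>X \<subseteq> W\<close> fin] \<open>X \<subseteq> W\<close> \<open>Y \<subseteq> W\<close>
    by (simp add: Un_commute)
qed

section \<open>The hyperbolic Koteljanskii inequality\<close>

theorem theorem2p6:
  fixes P :: "'n::{finite,linorder} matrix_poly"
    and S T :: "'n set"
    and A :: "real ^ 'n::{finite,linorder} ^ 'n::{finite,linorder}"
  assumes "lpm_polynomial P"
    and "homogeneous P"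
    and "psd_stable P"
    and "A \<in> hyperbolicity_cone P"
  shows "eval_poly (restriction S P) A * eval_poly (restriction T P) A
       \<ge> eval_poly (restriction (S \<union> T) P) A * eval_poly (restriction (S \<inter> T) P) A"
proof -
  have aff: "diag_affine P"
    using assms(1) by (rule lpm_polynomial_diag_affine)
  have ray: "rayleigh P"
    using aff assms(3) by (rule psd_stable_imp_rayleigh)
  have nz: "eval_poly P (mat 1 :: real ^ 'n::{finite,linorder} ^ 'n::{finite,linorder}) \<noteq> 0"
    using assms(3,2) by (rule psd_stable_homogeneous_identity)
  obtain \<sigma> :: real where \<sigma>: "\<sigma> * \<sigma> = 1"
    and pos: "\<And>\<epsilon>. 0 < \<epsilon> \<Longrightarrow> positive_ray \<sigma> P (A + mat \<epsilon>)"
    using assms(4) by (rule hyperbolicity_cone_sign) blast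
  have sym: "symmetric_matrix A"
    using assms(4) by (simp add: hyperbolicity_cone_def)
  have mat_lim: "((\<lambda>\<epsilon>. B + mat \<epsilon>) \<longlongrightarrow> B) (at_right 0)"
    for B :: "real ^ 'n::{finite,linorder} ^ 'n::{finite,linorder}"
  proof -
    have "((\<lambda>\<epsilon>. B + \<epsilon> *\<^sub>R mat 1) \<longlongrightarrow> B + 0 *\<^sub>R mat 1) (at_right 0)"
      by (intro tendsto_intros)
    then show ?thesis
      unfolding mat_scaleR[symmetric] by (simp add: mat_0)
  qed
  \<comment> \<open>The points A + \<epsilon> I are interior, and the sign at A itself follows by letting \<epsilon> tend to 0.\<close>
  have nonneg: "orthant_nonneg \<sigma> P A"
    unfolding orthant_nonneg_def
  proof (intro allI impI)
    fix y :: "'n \<Rightarrow> real"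
    assume y: "\<forall>i. 0 \<le> y i"
    have "((\<lambda>\<epsilon>. \<sigma> * eval_poly P (A + diag_mat y + mat \<epsilon>)) \<longlongrightarrow> \<sigma> * eval_poly P (A + diag_mat y)) (at_right 0)"
      by (intro tendsto_intros tendsto_eval_poly mat_lim)
    moreover have "eventually (\<lambda>\<epsilon>. 0 \<le> \<sigma> * eval_poly P (A + diag_mat y + mat \<epsilon>)) (at_right 0)"
      using eventually_at_right_less[of 0]
    proof eventually_elim
      case (elim \<epsilon>)
      have "positive_ray \<sigma> P (A + mat \<epsilon> + diag_mat y)"
        using y by (intro positive_ray_diag aff ray assms(2) nz pos elim) auto
      then have "0 < \<sigma> * eval_poly P (A + mat \<epsilon> + diag_mat y)"
        by (rule positive_ray_start)
      then show ?case
        by (simp add: add_ac)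
    qed
    ultimately show "0 \<le> \<sigma> * eval_poly P (A + diag_mat y)"
      by (rule tendsto_lowerbound) simp
  qed
  \<comment> \<open>The sign factor makes all values nonnegative; it enters both sides squared, that is, as 1.\<close>
  define h where "h U \<epsilon> = \<sigma> * eval_poly (diag_derivs U P) (A + mat \<epsilon>)" for U \<epsilon>
  let ?X = "- S" and ?Y = "- T"
  have h_lim: "(h U \<longlongrightarrow> h U 0) (at_right 0)" for U
    unfolding h_def mat_0 add_0_right by (intro tendsto_intros tendsto_eval_poly mat_lim)
  have h_nonneg: "0 \<le> h U \<epsilon>" if "0 \<le> \<epsilon>" for U \<epsilon>
    using orthant_nonneg_derivs[OF aff nonneg, of U] that
    by (simp add: h_def orthant_nonneg_def mat_eq_diag_mat)
  have local: "h U \<epsilon> * h (insert i (insert j U)) \<epsilon> \<le> h (insert i U) \<epsilon> * h (insert j U) \<epsilon>"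
    if "i \<notin> U" "j \<notin> U" "i \<noteq> j" for U i j \<epsilon>
  proof -
    have "eval_poly (diag_derivs U P) (A + mat \<epsilon>)
          * eval_poly (diag_deriv i (diag_deriv j (diag_derivs U P))) (A + mat \<epsilon>)
        \<le> eval_poly (diag_deriv i (diag_derivs U P)) (A + mat \<epsilon>)
          * eval_poly (diag_deriv j (diag_derivs U P)) (A + mat \<epsilon>)"
      using rayleigh_derivs[OF aff ray, of U] symmetric_matrix_mat[OF sym]
      by (simp only: rayleigh_def)
    moreover have "\<sigma> * a * (\<sigma> * b) = a * b" for a b
      using \<sigma> by (metis mult.assoc mult.commute mult_1)
    ultimately show ?thesis
      using that by (simp only: h_def diag_derivs_insert insert_iff simp_thms)
  qed
  have "h (?X \<inter> ?Y) 0 * h (?X \<union> ?Y) 0 \<le> h ?X 0 * h ?Y 0"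
  proof (cases "h (?X \<union> ?Y) 0 = 0")
    case True
    then show ?thesis
      using h_nonneg by simp
  next
    case False
    then have "0 < h (?X \<union> ?Y) 0"
      using h_nonneg[of 0 "?X \<union> ?Y"] by simp
    then have W: "0 < \<sigma> * eval_poly (diag_derivs (?X \<union> ?Y) P) A"
      by (simp only: h_def mat_0 add_0_right)
    have "h (?X \<inter> ?Y) \<epsilon> * h (?X \<union> ?Y) \<epsilon> \<le> h ?X \<epsilon> * h ?Y \<epsilon>" if "0 < \<epsilon>" for \<epsilon>
    proof (rule log_submodular_of_local[where W = "?X \<union> ?Y" and g = "\<lambda>U. h U \<epsilon>"])
      show "0 < h U \<epsilon>" if "U \<subseteq> ?X \<union> ?Y" for U
        unfolding h_def using aff nonneg W that \<open>0 < \<epsilon>\<close> by (rule orthant_nonneg_derivs_pos)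
    qed (auto intro: local)
    then have "eventually (\<lambda>\<epsilon>. h (?X \<inter> ?Y) \<epsilon> * h (?X \<union> ?Y) \<epsilon> \<le> h ?X \<epsilon> * h ?Y \<epsilon>) (at_right 0)"
      using eventually_at_right_less[of 0] by (auto elim: eventually_mono)
    then show ?thesis
      by (intro tendsto_le[OF _ _ _ \<open>eventually _ _\<close>] tendsto_mult h_lim) simp
  qed
  then have "\<sigma> * \<sigma> * (eval_poly (restriction (S \<union> T) P) A * eval_poly (restriction (S \<inter> T) P) A)
      \<le> \<sigma> * \<sigma> * (eval_poly (restriction S P) A * eval_poly (restriction T P) A)"
    by (simp add: h_def mat_0 mult_ac)
  then show ?thesis
    by (simp add: \<sigma>)
qed

end
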